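(* Let $\Gamma$ be a discrete subgroup of $\mathrm{PSL}(2,\mathbb{R})$ acting freely on $\mathbb{H}^2$ with $\Gamma\backslash\mathbb{H}^2$ compact. Then the horocycle flow $(\theta^{\mathcal X}_t)_{t\in\mathbb{R}}$ on $\mathcal X=T^1(\Gamma\backslash\mathbb{H}^2)$ is not BW-expansive.
   Context: Setting: $\mathbb{H}^2=\{z=x+iy\in\mathbb{C}: y>0\}$ is the hyperbolic plane with metric $ds^2=(dx^2+dy^2)/y^2$, on which $G=\mathrm{PSL}(2,\mathbb{R})=\mathrm{SL}(2,\mathbb{R})/\{\pm E_2\}$ acts by Möbius transformations. $X=\Gamma\backslash \mathrm{PSL}(2,\mathbb{R})=\{\Gamma g: g\in \mathrm{PSL}(2,\mathbb{R})\}$. $G$ carries a distance $d_G$ induced by a natural left-invariant Riemannian metric (normalized so that the class $a_t$ of $\mathrm{diag}(e^{t/2},e^{-t/2})$ satisfies $d_G(a_t,e)=|t|/\sqrt2$), and $X$ carries the distance $d_X(\Gamma g_1,\Gamma g_2)=\inf_{\gamma\in\Gamma}d_G(g_1,\gamma g_2)$. The unit tangent bundle $\mathcal X=T^1(\Gamma\backslash\mathbb{H}^2)$ is identified with $X$ by the standard bijection $\Xi:\mathcal X\to X$, whose inverse sends $\Gamma g$ to the image in $\mathcal X$ of the vertical unit vector at $i\in\mathbb{H}^2$ moved by $g$; the distance on $\mathcal X$ is the one making $\Xi$ an isometry. Horocycle flow: "the horocycle flow" means the stable one. Let $b_t\in\mathrm{PSL}(2,\mathbb{R})$ be the class of $\begin{pmatrix}1&t\\0&1\end{pmatrix}$.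 Put $\theta_t(\Gamma g)=\Gamma g b_t$ on $X$; the horocycle flow on $\mathcal X$ is $\theta^{\mathcal X}_t=\Xi^{-1}\circ\theta_t\circ\Xi$. BW-expansive (expansive in the sense of Bowen-Walters): a continuous flow $\phi:\mathbb{R}\times M\to M$ on a compact metric space $(M,d)$ is BW-expansive if for each $\varepsilon>0$ there exists $\delta>0$ such that, for all $x,y\in M$ and every continuous function $s:\mathbb{R}\to\mathbb{R}$ with $s(0)=0$, if $d(\phi_t(x),\phi_{s(t)}(y))<\delta$ for all $t\in\mathbb{R}$, then $y=\phi_\tau(x)$ for some $\tau\in(-\varepsilon,\varepsilon)$. *)

theory Defs
  imports "HOL-Analysis.Analysis" "HOL-Algebra.Group_Action"
begin

section \<open>Quotient topology\<close>

definition quotient_topology :: "'a topology \<Rightarrow> ('a \<Rightarrow> 'b) \<Rightarrow> 'b topology" where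
  "quotient_topology X q =
     topology (\<lambda>U. U \<subseteq> q ` topspace X \<and> openin X {x \<in> topspace X. q x \<in> U})"

lemma openin_quotient_topology:
  "openin (quotient_topology X q) U \<longleftrightarrow>
     U \<subseteq> q ` topspace X \<and> openin X {x \<in> topspace X. q x \<in> U}"
proof -
  let ?L = "\<lambda>U. U \<subseteq> q ` topspace X \<and> openin X {x \<in> topspace X. q x \<in> U}"
  have "istopology ?L"
    unfolding istopology_def
  proof (intro conjI allI impI)
    fix S T assume S: "?L S" and T: "?L T"
    have "{x \<in> topspace X. q x \<in> S \<inter> T} =
        {x \<in> topspace X. q x \<in> S} \<inter> {x \<in> topspace X. q x \<in> T}"
      by blast
    then show "openin X {x \<in> topspace X. q x \<in> S \<inter> T}"
      using S T by (simp add: openin_Int)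
    show "S \<inter> T \<subseteq> q ` topspace X" using S by blast
  next
    fix K assume K: "\<forall>S\<in>K. ?L S"
    have "{x \<in> topspace X. q x \<in> \<Union>K} = (\<Union>S\<in>K. {x \<in> topspace X. q x \<in> S})"
      by blast
    then show "openin X {x \<in> topspace X. q x \<in> \<Union>K}"
      using K by auto
    show "\<Union>K \<subseteq> q ` topspace X" using K by blast
  qed
  then show ?thesis
    unfolding quotient_topology_def by (simp add: topology_inverse')
qed

lemma topspace_quotient_topology [simp]:
  "topspace (quotient_topology X q) = q ` topspace X"
proof -
  have "{x \<in> topspace X. q x \<in> q ` topspace X} = topspace X" by blast
  then have "openin (quotient_topology X q) (q ` topspace X)"
    by (simp add: openin_quotient_topology)
  moreover have "topspace (quotient_topology X q) \<subseteq> q ` topspace X"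
    using openin_topspace[of "quotient_topology X q"] unfolding openin_quotient_topology by (rule conjunct1)
  ultimately show ?thesis
    by (simp add: openin_subset subset_antisym)
qed

lemma quotient_map_quotient_topology: "quotient_map X (quotient_topology X q) q"
  by (auto simp: quotient_map_def openin_quotient_topology)


section \<open>The group \<open>PSL(2,\<real>)\<close>\<close>

definition SL2 :: "(real^2^2) monoid" where
  "SL2 = \<lparr>carrier = {A. det A = 1}, mult = (**), one = mat 1\<rparr>"

abbreviation PM1 :: "(real^2^2) set" where
  "PM1 \<equiv> {mat 1, - mat 1}"

definition PSL2 :: "(real^2^2) set monoid" where
  "PSL2 = SL2 Mod PM1"

definition psl :: "real^2^2 \<Rightarrow> (real^2^2) set" where
  "psl A = PM1 #>\<^bsub>SL2\<^esub> A"

definition PSL2_topology :: "(real^2^2) set topology" where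
  "PSL2_topology = quotient_topology (top_of_set (carrier SL2)) psl"

lemma minus_matrix_mult: "(- A) ** B = - (A ** B)" "A ** (- B) = - (A ** B)"
  for A B :: "real^2^2"
  by (simp_all add: matrix_matrix_mult_def vec_eq_iff sum_negf)

lemma det_minus_2: "det (- A) = det A" for A :: "real^2^2"
  by (simp add: det_2)

lemma psl_eq: "psl A = {A, - A}"
  by (auto simp: psl_def r_coset_def SL2_def minus_matrix_mult)

lemma group_SL2: "Group.group SL2"
proof (rule groupI)
  fix A assume A: "A \<in> carrier SL2"
  then have "invertible A"
    by (simp add: SL2_def invertible_det_nz)
  then have inv: "matrix_inv A ** A = mat 1"
    unfolding invertible_def matrix_inv_def by (rule someI2_ex) blast
  then have "det (matrix_inv A) * det A = 1"
    by (metis det_I det_mul)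
  then have "matrix_inv A \<in> carrier SL2"
    using A by (simp add: SL2_def)
  then show "\<exists>B\<in>carrier SL2. B \<otimes>\<^bsub>SL2\<^esub> A = \<one>\<^bsub>SL2\<^esub>"
    using inv by (auto simp: SL2_def)
qed (auto simp: SL2_def det_mul matrix_mul_assoc)

lemma normal_PM1: "PM1 \<lhd> SL2"
proof -
  interpret Group.group SL2 by (rule group_SL2)
  have "subgroup PM1 SL2"
  proof (rule subgroupI)
    show "PM1 \<subseteq> carrier SL2" by (auto simp: SL2_def det_minus_2)
    fix A assume A: "A \<in> PM1"
    then have "A \<otimes>\<^bsub>SL2\<^esub> A = \<one>\<^bsub>SL2\<^esub>" "A \<in> carrier SL2"
      by (auto simp: SL2_def minus_matrix_mult det_minus_2)
    then have "inv\<^bsub>SL2\<^esub> A = A" by (metis inv_equality)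
    then show "inv\<^bsub>SL2\<^esub> A \<in> PM1" using A by simp
  next
    fix A B assume "A \<in> PM1" "B \<in> PM1"
    then show "A \<otimes>\<^bsub>SL2\<^esub> B \<in> PM1" by (auto simp: SL2_def minus_matrix_mult)
  qed auto
  moreover have "PM1 #>\<^bsub>SL2\<^esub> A = A <#\<^bsub>SL2\<^esub> PM1" for A
    by (auto simp: r_coset_def l_coset_def SL2_def minus_matrix_mult)
  ultimately show ?thesis by (intro normalI) auto
qed

lemma group_PSL2: "Group.group PSL2"
  unfolding PSL2_def by (rule normal.factorgroup_is_group[OF normal_PM1])

lemma carrier_PSL2: "carrier PSL2 = psl ` {A. det A = 1}"
  by (simp add: PSL2_def carrier_FactGroup SL2_def psl_def)

lemma psl_mult:
  assumes "det A = 1" "det B = 1"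
  shows "psl A \<otimes>\<^bsub>PSL2\<^esub> psl B = psl (A ** B)"
  by (auto simp: PSL2_def psl_eq set_mult_def SL2_def minus_matrix_mult)

lemma one_PSL2: "\<one>\<^bsub>PSL2\<^esub> = psl (mat 1)"
  by (simp add: PSL2_def psl_eq)

lemma topspace_PSL2_topology: "topspace PSL2_topology = carrier PSL2"
  by (simp add: PSL2_topology_def carrier_PSL2 SL2_def)


section \<open>Riemannian distances on \<open>PSL(2,\<real>)\<close> and \<open>\<Gamma>\<setminus>PSL(2,\<real>)\<close>\<close>

text \<open>
  The left-invariant metric is the one given on the Lie algebra by
  \<open>\<langle>V, W\<rangle> = tr (V\<^sup>T W)\<close>, so a tangent vector \<open>V\<close> at \<open>A\<close> has length equal to the Frobenius norm
  of \<open>A\<^sup>-\<^sup>1 V\<close>; the norm of type \<open>real^2^2\<close> is the Frobenius norm.  The velocity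
  \<open>diag(1/2,-1/2)\<close> of \<open>a\<^sub>t\<close> then has length \<open>1/sqrt 2\<close>.

  As \<open>SL(2,\<real>) \<rightarrow> PSL(2,\<real>)\<close> is a two-sheeted covering, curves in \<open>PSL(2,\<real>)\<close> are the
  projections of curves in \<open>SL(2,\<real>)\<close>.

  \<open>valid_path\<close> (continuous, \<open>C\<^sup>1\<close> off a finite set) does not bound the speed near the exceptional
  points, and \<open>integral\<close> of a non-integrable speed would be \<open>0\<close>; hence \<open>has_integral\<close>.
\<close>

definition dist_PSL2 :: "(real^2^2) set \<Rightarrow> (real^2^2) set \<Rightarrow> real" where
  "dist_PSL2 g h = Inf {L. \<exists>c. valid_path c \<and> path_image c \<subseteq> carrier SL2 \<and>
      psl (pathstart c) = g \<and> psl (pathfinish c) = h \<and>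
      ((\<lambda>s. norm (matrix_inv (c s) ** vector_derivative c (at s within {0..1})))
         has_integral L) {0..1}}"

text \<open>The elements of \<open>X\<close> are the cosets \<open>\<Gamma>g\<close>, i.e.\ \<open>X = rcosets\<^bsub>PSL2\<^esub> \<Gamma>\<close>.\<close>

definition dist_X ::
  "(real^2^2) set set \<Rightarrow> (real^2^2) set set \<Rightarrow> (real^2^2) set set \<Rightarrow> real" where
  "dist_X \<Gamma> C D =
     (let g1 = (SOME g. g \<in> C); g2 = (SOME g. g \<in> D)
      in INF \<gamma>\<in>\<Gamma>. dist_PSL2 g1 (\<gamma> \<otimes>\<^bsub>PSL2\<^esub> g2))"


section \<open>Actions on the hyperbolic plane and its unit tangent bundle\<close>

definition H2 :: "complex set" where
  "H2 = {z. Im z > 0}"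

definition moebius_map :: "real^2^2 \<Rightarrow> complex \<Rightarrow> complex" where
  "moebius_map A z = (of_real (A$1$1) * z + of_real (A$1$2)) / (of_real (A$2$1) * z + of_real (A$2$2))"

definition psl_moebius :: "(real^2^2) set \<Rightarrow> complex \<Rightarrow> complex" where
  "psl_moebius g z = moebius_map (SOME A. A \<in> g) z"

text \<open>A tangent vector is a pair of a base point and a complex number; the hyperbolic length of
  \<open>v\<close> at \<open>z\<close> is \<open>\<bar>v\<bar> / Im z\<close>.\<close>

definition T1H2 :: "(complex \<times> complex) set" where
  "T1H2 = {(z, v). z \<in> H2 \<and> cmod v / Im z = 1}"

definition psl_tangent :: "(real^2^2) set \<Rightarrow> complex \<times> complex \<Rightarrow> complex \<times> complex" where
  "psl_tangent g = (\<lambda>(z, v). (psl_moebius g z, deriv (psl_moebius g) z * v))"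

definition acts_freely_on_H2 :: "(real^2^2) set set \<Rightarrow> bool" where
  "acts_freely_on_H2 \<Gamma> \<longleftrightarrow> (\<forall>\<gamma>\<in>\<Gamma>. \<forall>z\<in>H2. psl_moebius \<gamma> z = z \<longrightarrow> \<gamma> = \<one>\<^bsub>PSL2\<^esub>)"

definition quotient_H2 :: "(real^2^2) set set \<Rightarrow> complex set topology" where
  "quotient_H2 \<Gamma> =
     quotient_topology (top_of_set H2) (orbit (PSL2\<lparr>carrier := \<Gamma>\<rparr>) psl_moebius)"

text \<open>For a free properly discontinuous action, the tangent vectors of \<open>\<Gamma>\<setminus>H2\<close> are the
  \<open>\<Gamma>\<close>-orbits of the tangent vectors of \<open>H2\<close>.\<close>

definition T1_quotient :: "(real^2^2) set set \<Rightarrow> (complex \<times> complex) set set" where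
  "T1_quotient \<Gamma> = orbits (PSL2\<lparr>carrier := \<Gamma>\<rparr>) T1H2 psl_tangent"

definition Xi_inv :: "(real^2^2) set set \<Rightarrow> (real^2^2) set set \<Rightarrow> (complex \<times> complex) set" where
  "Xi_inv \<Gamma> C = orbit (PSL2\<lparr>carrier := \<Gamma>\<rparr>) psl_tangent (psl_tangent (SOME g. g \<in> C) (\<i>, \<i>))"

definition Xi :: "(real^2^2) set set \<Rightarrow> (complex \<times> complex) set \<Rightarrow> (real^2^2) set set" where
  "Xi \<Gamma> = inv_into (rcosets\<^bsub>PSL2\<^esub> \<Gamma>) (Xi_inv \<Gamma>)"

definition dist_T1 ::
  "(real^2^2) set set \<Rightarrow> (complex \<times> complex) set \<Rightarrow> (complex \<times> complex) set \<Rightarrow> real" where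
  "dist_T1 \<Gamma> p q = dist_X \<Gamma> (Xi \<Gamma> p) (Xi \<Gamma> q)"


section \<open>The horocycle flow and expansiveness\<close>

definition b_elem :: "real \<Rightarrow> (real^2^2) set" where
  "b_elem t = psl (vector [vector [1, t], vector [0, 1]])"

definition horocycle_X :: "real \<Rightarrow> (real^2^2) set set \<Rightarrow> (real^2^2) set set" where
  "horocycle_X t C = C #>\<^bsub>PSL2\<^esub> b_elem t"

definition horocycle_T1 ::
  "(real^2^2) set set \<Rightarrow> real \<Rightarrow> (complex \<times> complex) set \<Rightarrow> (complex \<times> complex) set" where
  "horocycle_T1 \<Gamma> t = Xi_inv \<Gamma> \<circ> horocycle_X t \<circ> Xi \<Gamma>"

definition BW_expansive :: "'a set \<Rightarrow> ('a \<Rightarrow> 'a \<Rightarrow> real) \<Rightarrow> (real \<Rightarrow> 'a \<Rightarrow> 'a) \<Rightarrow> bool" where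
  "BW_expansive M d \<phi> \<longleftrightarrow>
     (\<forall>\<epsilon>>0. \<exists>\<delta>>0. \<forall>x\<in>M. \<forall>y\<in>M. \<forall>s::real \<Rightarrow> real.
        continuous_on UNIV s \<longrightarrow> s 0 = 0 \<longrightarrow>
        (\<forall>t. d (\<phi> t x) (\<phi> (s t) y) < \<delta>) \<longrightarrow>
        (\<exists>\<tau>\<in>{-\<epsilon><..<\<epsilon>}. y = \<phi> \<tau> x))"


section \<open>\<open>\<Xi>\<close> is a well-defined bijection\<close>

lemma moebius_minus: "moebius_map (- A) = moebius_map A"
proof
  fix z :: complex
  have "moebius_map (- A) z = (- (of_real (A$1$1) * z + of_real (A$1$2))) /
      (- (of_real (A$2$1) * z + of_real (A$2$2)))"
    by (simp add: moebius_map_def)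
  also have "\<dots> = moebius_map A z"
    unfolding moebius_map_def by (rule minus_divide_divide)
  finally show "moebius_map (- A) z = moebius_map A z" .
qed

lemma psl_moebius_psl: "psl_moebius (psl A) = moebius_map A"
proof
  fix z
  have "(SOME B. B \<in> psl A) \<in> psl A" by (rule someI[of _ A]) (simp add: psl_eq)
  then show "psl_moebius (psl A) z = moebius_map A z"
    unfolding psl_moebius_def by (auto simp: psl_eq moebius_minus)
qed

lemma moebius_denom_nz:
  fixes A :: "real^2^2"
  assumes "det A = 1" "z \<in> H2"
  shows "of_real (A$2$1) * z + of_real (A$2$2) \<noteq> (0::complex)"
proof
  assume "of_real (A$2$1) * z + of_real (A$2$2) = (0::complex)"
  then have "A$2$1 * Im z = 0" "A$2$1 * Re z + A$2$2 = 0"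
    by (simp_all add: complex_eq_iff)
  then have "A$2$1 = 0" "A$2$2 = 0" using assms by (auto simp: H2_def)
  then show False using assms by (simp add: det_2)
qed

lemma deriv_moebius:
  assumes "det A = 1" "z \<in> H2"
  shows "deriv (moebius_map A) z = 1 / (of_real (A$2$1) * z + of_real (A$2$2))^2"
proof (rule DERIV_imp_deriv)
  have d: "of_real (A$1$1) * of_real (A$2$2) - of_real (A$1$2) * of_real (A$2$1) = (1::complex)"
    using assms(1) by (simp add: det_2 flip: of_real_mult of_real_diff)
  have "(moebius_map A has_field_derivative
     (of_real (A$1$1) * (of_real (A$2$1) * z + of_real (A$2$2))
       - (of_real (A$1$1) * z + of_real (A$1$2)) * of_real (A$2$1)) /
     ((of_real (A$2$1) * z + of_real (A$2$2)) * (of_real (A$2$1) * z + of_real (A$2$2)))) (at z)"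
    unfolding moebius_map_def using moebius_denom_nz[OF assms]
    by (auto intro!: derivative_eq_intros)
  moreover have "of_real (A$1$1) * (of_real (A$2$1) * z + of_real (A$2$2))
       - (of_real (A$1$1) * z + of_real (A$1$2)) * of_real (A$2$1) = (1::complex)"
    using d by (simp add: algebra_simps)
  ultimately show "(moebius_map A has_field_derivative
      1 / (of_real (A$2$1) * z + of_real (A$2$2))^2) (at z)"
    by (simp add: power2_eq_square)
qed

lemma Im_moebius:
  assumes "det A = 1" "z \<in> H2"
  shows "Im (moebius_map A z) = Im z / (cmod (of_real (A$2$1) * z + of_real (A$2$2)))^2"
proof -
  let ?w = "of_real (A$2$1) * z + of_real (A$2$2) :: complex"
  have d: "A$1$1 * A$2$2 = 1 + A$1$2 * A$2$1" using assms(1) by (simp add: det_2)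
  have "A$1$1 * Im z * (A$2$1 * Re z + A$2$2) - (A$1$1 * Re z + A$1$2) * (A$2$1 * Im z)
    = (A$1$1 * A$2$2 - A$1$2 * A$2$1) * Im z" by (simp add: algebra_simps)
  then show ?thesis
    using d by (simp add: moebius_map_def Im_divide cmod_power2)
qed

lemma psl_tangent_psl:
  assumes "det A = 1" "z \<in> H2"
  shows "psl_tangent (psl A) (z, v) =
    (moebius_map A z, v / (of_real (A$2$1) * z + of_real (A$2$2))^2)"
  using assms by (simp add: psl_tangent_def psl_moebius_psl deriv_moebius)

lemma moebius_in_H2: "det A = 1 \<Longrightarrow> z \<in> H2 \<Longrightarrow> moebius_map A z \<in> H2"
  using moebius_denom_nz[of A z] Im_moebius[of A z] by (simp add: H2_def)

lemma psl_tangent_in_T1H2: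
  assumes "g \<in> carrier PSL2" "p \<in> T1H2"
  shows "psl_tangent g p \<in> T1H2"
  using assms moebius_denom_nz
  by (auto simp: carrier_PSL2 T1H2_def psl_tangent_psl moebius_in_H2 Im_moebius norm_divide
      norm_power)

lemma moebius_mult_aux:
  fixes A B :: "real^2^2"
  assumes "det A = 1" "det B = 1" "z \<in> H2"
  shows "of_real ((A ** B)$2$1) * z + of_real ((A ** B)$2$2) =
      (of_real (A$2$1) * moebius_map B z + of_real (A$2$2)) *
      (of_real (B$2$1) * z + of_real (B$2$2))"
    "moebius_map (A ** B) z = moebius_map A (moebius_map B z)"
proof -
  define p q where "p = (of_real (B$1$1) * z + of_real (B$1$2) :: complex)"
    and "q = (of_real (B$2$1) * z + of_real (B$2$2) :: complex)"
  have q: "q \<noteq> 0" using moebius_denom_nz[OF assms(2,3)] by (simp add: q_def)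
  have m: "moebius_map B z = p / q" by (simp add: moebius_map_def p_def q_def)
  have *: "of_real ((A ** B)$i$1) * z + of_real ((A ** B)$i$2) =
      of_real (A$i$1) * p + of_real (A$i$2) * q" for i
    by (simp add: matrix_matrix_mult_def sum_2 p_def q_def algebra_simps)
  have **: "of_real (A$i$1) * p + of_real (A$i$2) * q
      = (of_real (A$i$1) * (p / q) + of_real (A$i$2)) * q" for i
    using q by (simp add: algebra_simps)
  show "of_real ((A ** B)$2$1) * z + of_real ((A ** B)$2$2) =
      (of_real (A$2$1) * moebius_map B z + of_real (A$2$2)) *
      (of_real (B$2$1) * z + of_real (B$2$2))"
    unfolding * ** m q_def[symmetric] ..
  show "moebius_map (A ** B) z = moebius_map A (moebius_map B z)"
    unfolding m moebius_map_def[of "A ** B"] moebius_map_def[of A] * ** using q by simp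
qed

lemma psl_tangent_mult:
  assumes "g \<in> carrier PSL2" "h \<in> carrier PSL2" "p \<in> T1H2"
  shows "psl_tangent (g \<otimes>\<^bsub>PSL2\<^esub> h) p = psl_tangent g (psl_tangent h p)"
proof -
  obtain A B where A: "g = psl A" "det A = 1" and B: "h = psl B" "det B = 1"
    using assms by (auto simp: carrier_PSL2)
  obtain z v where p: "p = (z, v)" "z \<in> H2" using assms by (auto simp: T1H2_def)
  have "det (A ** B) = 1" using A B by (simp add: det_mul)
  then show ?thesis
    using A B p
    by (simp add: psl_mult psl_tangent_psl moebius_in_H2 moebius_mult_aux power_mult_distrib)
qed

lemma i_in_T1H2: "(\<i>, \<i>) \<in> T1H2"
  by (simp add: T1H2_def H2_def)

lemma psl_tangent_one: "p \<in> T1H2 \<Longrightarrow> psl_tangent \<one>\<^bsub>PSL2\<^esub> p = p"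
  unfolding one_PSL2 by (cases p) (simp add: T1H2_def psl_tangent_psl moebius_map_def, simp add: mat_def)

lemma psl_tangent_stabilizer:
  assumes "g \<in> carrier PSL2" "psl_tangent g (\<i>, \<i>) = (\<i>, \<i>)"
  shows "g = \<one>\<^bsub>PSL2\<^esub>"
proof -
  obtain A where A: "g = psl A" "det A = 1" using assms by (auto simp: carrier_PSL2)
  let ?w = "of_real (A$2$1) * \<i> + of_real (A$2$2) :: complex"
  have i: "\<i> \<in> H2" by (simp add: H2_def)
  have w: "?w \<noteq> 0" using moebius_denom_nz[OF A(2) i] .
  have m: "moebius_map A \<i> = \<i>" and s: "\<i> / ?w^2 = \<i>"
    using assms(2) A i by (simp_all add: psl_tangent_psl)
  have "?w^2 = 1" using s w by (simp add: field_simps)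
  then have "?w = 1 \<or> ?w = -1" by (simp add: power2_eq_1_iff)
  then have c: "A$2$1 = 0" "A$2$2 = 1 \<or> A$2$2 = -1"
    by (auto simp: complex_eq_iff)
  have "of_real (A$1$1) * \<i> + of_real (A$1$2) = \<i> * ?w"
    using m w by (simp add: moebius_map_def field_simps)
  then have "A$1$2 = - A$2$1" "A$1$1 = A$2$2" by (auto simp: complex_eq_iff)
  then have "A = mat 1 \<or> A = - mat 1"
    using c by (auto simp: vec_eq_iff forall_2 mat_def)
  then show ?thesis using A by (auto simp: one_PSL2 psl_eq)
qed

lemma psl_tangent_transitive:
  assumes "p \<in> T1H2"
  shows "\<exists>g\<in>carrier PSL2. psl_tangent g (\<i>, \<i>) = p"
proof -
  obtain z v where p: "p = (z, v)" "Im z > 0" "cmod v = Im z"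
    using assms by (auto simp: T1H2_def H2_def)
  define y where "y = Im z"
  have y: "y > 0" using p by (simp add: y_def)
  have v0: "v \<noteq> 0" using p by auto
  define w where "w = csqrt (\<i> / v)"
  have w2: "w^2 = \<i> / v" by (simp add: w_def)
  have "cmod w ^ 2 = 1 / y" using w2 p by (metis norm_divide norm_ii norm_power y_def)
  then have cd: "(Im w)^2 + (Re w)^2 = 1 / y" by (simp add: cmod_power2 add.commute)
  have w0: "w \<noteq> 0" using w2 v0 by auto
  define q where "q = z * w"
  define A :: "real^2^2" where "A = vector [vector [Im q, Re q], vector [Im w, Re w]]"
  have entries: "A$1$1 = Im q" "A$1$2 = Re q" "A$2$1 = Im w" "A$2$2 = Re w"
    by (simp_all add: A_def)
  have "det A = y * ((Im w)^2 + (Re w)^2)"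
    by (simp add: det_2 entries q_def y_def power2_eq_square algebra_simps)
  then have A: "det A = 1" using cd y by simp
  have "of_real (Im u) * \<i> + of_real (Re u) = u" for u by (simp add: complex_eq_iff)
  then have "moebius_map A \<i> = q / w" "of_real (A$2$1) * \<i> + of_real (A$2$2) = w"
    by (simp_all add: moebius_map_def entries)
  then have "psl_tangent (psl A) (\<i>, \<i>) = (q / w, \<i> / w^2)"
    using A by (simp add: psl_tangent_psl H2_def)
  also have "\<dots> = p" using w0 v0 by (simp add: q_def w2 p)
  finally show ?thesis using A by (auto simp: carrier_PSL2)
qed

lemma Xi_inv_coset:
  assumes \<Gamma>: "subgroup \<Gamma> PSL2" and g: "g \<in> carrier PSL2"
  shows "Xi_inv \<Gamma> (\<Gamma> #>\<^bsub>PSL2\<^esub> g) =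
    orbit (PSL2\<lparr>carrier := \<Gamma>\<rparr>) psl_tangent (psl_tangent g (\<i>, \<i>))"
proof -
  interpret Group.group PSL2 by (rule group_PSL2)
  interpret \<Gamma>: subgroup \<Gamma> PSL2 by (rule \<Gamma>)
  let ?h = "SOME h. h \<in> \<Gamma> #>\<^bsub>PSL2\<^esub> g"
  have "?h \<in> \<Gamma> #>\<^bsub>PSL2\<^esub> g" by (rule someI) (rule rcos_self[OF g \<Gamma>])
  then obtain k where k: "k \<in> \<Gamma>" "?h = k \<otimes>\<^bsub>PSL2\<^esub> g" by (auto simp: r_coset_def)
  let ?p = "psl_tangent g (\<i>, \<i>)"
  have p: "?p \<in> T1H2" using g i_in_T1H2 by (rule psl_tangent_in_T1H2)
  have h: "psl_tangent ?h (\<i>, \<i>) = psl_tangent k ?p"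
    using k g i_in_T1H2 by (simp add: psl_tangent_mult)
  have 1: "psl_tangent l (psl_tangent k ?p) = psl_tangent (l \<otimes>\<^bsub>PSL2\<^esub> k) ?p" if "l \<in> \<Gamma>" for l
    using that k p by (simp add: psl_tangent_mult)
  have 2: "psl_tangent l ?p = psl_tangent (l \<otimes>\<^bsub>PSL2\<^esub> inv\<^bsub>PSL2\<^esub> k) (psl_tangent k ?p)"
    if "l \<in> \<Gamma>" for l
    using that k by (subst 1) (auto simp: m_assoc)
  show ?thesis
    unfolding Xi_inv_def orbit_def h
  proof (intro equalityI subsetI)
    fix x assume "x \<in> {psl_tangent l (psl_tangent k ?p) | l. l \<in> carrier (PSL2\<lparr>carrier := \<Gamma>\<rparr>)}"
    then obtain l where "l \<in> \<Gamma>" "x = psl_tangent (l \<otimes>\<^bsub>PSL2\<^esub> k) ?p"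
      using 1 by auto
    then show "x \<in> {psl_tangent l ?p | l. l \<in> carrier (PSL2\<lparr>carrier := \<Gamma>\<rparr>)}"
      using k(1) by auto
  next
    fix x assume "x \<in> {psl_tangent l ?p | l. l \<in> carrier (PSL2\<lparr>carrier := \<Gamma>\<rparr>)}"
    then obtain l where "l \<in> \<Gamma>"
        "x = psl_tangent (l \<otimes>\<^bsub>PSL2\<^esub> inv\<^bsub>PSL2\<^esub> k) (psl_tangent k ?p)"
      using 2 by auto
    then show "x \<in> {psl_tangent l (psl_tangent k ?p) | l. l \<in> carrier (PSL2\<lparr>carrier := \<Gamma>\<rparr>)}"
      using k(1) by auto
  qed
qed

lemma bij_betw_Xi_inv:
  assumes \<Gamma>: "subgroup \<Gamma> PSL2"
  shows "bij_betw (Xi_inv \<Gamma>) (rcosets\<^bsub>PSL2\<^esub> \<Gamma>) (T1_quotient \<Gamma>)"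
  unfolding bij_betw_def
proof
  interpret Group.group PSL2 by (rule group_PSL2)
  interpret \<Gamma>: subgroup \<Gamma> PSL2 by (rule \<Gamma>)
  show "inj_on (Xi_inv \<Gamma>) (rcosets\<^bsub>PSL2\<^esub> \<Gamma>)"
  proof (rule inj_onI)
    fix C D assume C: "C \<in> rcosets\<^bsub>PSL2\<^esub> \<Gamma>" and D: "D \<in> rcosets\<^bsub>PSL2\<^esub> \<Gamma>"
      and eq: "Xi_inv \<Gamma> C = Xi_inv \<Gamma> D"
    obtain g where g: "g \<in> carrier PSL2" "C = \<Gamma> #>\<^bsub>PSL2\<^esub> g" using C by (auto simp: RCOSETS_def)
    obtain h where h: "h \<in> carrier PSL2" "D = \<Gamma> #>\<^bsub>PSL2\<^esub> h" using D by (auto simp: RCOSETS_def)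
    have "psl_tangent g (\<i>, \<i>) \<in> Xi_inv \<Gamma> C"
      unfolding g(2) Xi_inv_coset[OF \<Gamma> g(1)] orbit_def
      using psl_tangent_one[OF psl_tangent_in_T1H2[OF g(1) i_in_T1H2], symmetric] \<Gamma>.one_closed
      by auto
    then obtain k where k: "k \<in> \<Gamma>" "psl_tangent g (\<i>, \<i>) = psl_tangent k (psl_tangent h (\<i>, \<i>))"
      unfolding eq h(2) Xi_inv_coset[OF \<Gamma> h(1)] orbit_def by auto
    let ?u = "inv\<^bsub>PSL2\<^esub> (k \<otimes>\<^bsub>PSL2\<^esub> h)"
    have kh: "k \<otimes>\<^bsub>PSL2\<^esub> h \<in> carrier PSL2" using k h by simp
    have "psl_tangent (?u \<otimes>\<^bsub>PSL2\<^esub> g) (\<i>, \<i>) = psl_tangent ?u (psl_tangent (k \<otimes>\<^bsub>PSL2\<^esub> h) (\<i>, \<i>))"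
      using k g h i_in_T1H2 kh by (simp add: psl_tangent_mult)
    also have "\<dots> = psl_tangent (?u \<otimes>\<^bsub>PSL2\<^esub> (k \<otimes>\<^bsub>PSL2\<^esub> h)) (\<i>, \<i>)"
      using kh i_in_T1H2 by (simp only: psl_tangent_mult inv_closed)
    also have "\<dots> = (\<i>, \<i>)"
      using kh by (simp only: l_inv psl_tangent_one i_in_T1H2)
    finally have "?u \<otimes>\<^bsub>PSL2\<^esub> g = \<one>\<^bsub>PSL2\<^esub>"
      using kh g by (intro psl_tangent_stabilizer) auto
    then have "inv\<^bsub>PSL2\<^esub> g = ?u"
      using kh g(1) by (intro inv_equality) auto
    then have "inv\<^bsub>PSL2\<^esub> (inv\<^bsub>PSL2\<^esub> g) = inv\<^bsub>PSL2\<^esub> ?u" by (rule arg_cong)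
    then have "g = k \<otimes>\<^bsub>PSL2\<^esub> h"
      unfolding inv_inv[OF kh] inv_inv[OF g(1)] .
    then have "g \<in> \<Gamma> #>\<^bsub>PSL2\<^esub> h" using k by (auto simp: r_coset_def)
    then show "C = D" using repr_independence[OF _ h(1) \<Gamma>] g h by simp
  qed
  show "Xi_inv \<Gamma> ` (rcosets\<^bsub>PSL2\<^esub> \<Gamma>) = T1_quotient \<Gamma>"
  proof (intro equalityI subsetI)
    fix P assume "P \<in> Xi_inv \<Gamma> ` (rcosets\<^bsub>PSL2\<^esub> \<Gamma>)"
    then obtain g where g: "g \<in> carrier PSL2" "P = Xi_inv \<Gamma> (\<Gamma> #>\<^bsub>PSL2\<^esub> g)"
      by (auto simp: RCOSETS_def)
    show "P \<in> T1_quotient \<Gamma>"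
      unfolding g(2) Xi_inv_coset[OF \<Gamma> g(1)] T1_quotient_def orbits_def
      using psl_tangent_in_T1H2[OF g(1) i_in_T1H2] by blast
  next
    fix P assume "P \<in> T1_quotient \<Gamma>"
    then obtain p where p: "p \<in> T1H2" "P = orbit (PSL2\<lparr>carrier := \<Gamma>\<rparr>) psl_tangent p"
      by (auto simp: T1_quotient_def orbits_def)
    then obtain g where g: "g \<in> carrier PSL2" "psl_tangent g (\<i>, \<i>) = p"
      using psl_tangent_transitive by blast
    then have "Xi_inv \<Gamma> (\<Gamma> #>\<^bsub>PSL2\<^esub> g) = P"
      using p Xi_inv_coset[OF \<Gamma>] by simp
    then show "P \<in> Xi_inv \<Gamma> ` (rcosets\<^bsub>PSL2\<^esub> \<Gamma>)"
      using rcosetsI[OF \<Gamma>.subset g(1)] by blast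
  qed
qed

end

theory Submission
  imports Defs
begin

text \<open>
  The relation \<open>b\<^sub>t a\<^sub>r = a\<^sub>r b\<^sub>s\<close> with \<open>s = t e\<^sup>-\<^sup>r\<close> shows that the orbits of \<open>\<Gamma>\<close> and of \<open>\<Gamma>a\<^sub>r\<close> stay
  at distance at most \<open>|r|\<close> after a linear change of time.  If \<open>\<Gamma>a\<^sub>r = \<Gamma>b\<^sub>\<tau>\<close>, then
  \<open>a\<^sub>r b\<^sub>-\<^sub>\<tau>\<close> lies in \<open>\<Gamma>\<close>, and for small \<open>r\<close> and \<open>\<tau>\<close> it is so close to the identity that
  discreteness makes it equal to the identity, hence \<open>r = 0\<close>.
\<close>

section \<open>Upper triangular matrices\<close>

definition upper_tri :: "real \<Rightarrow> real \<Rightarrow> real \<Rightarrow> real^2^2" where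
  "upper_tri a b d = vector [vector [a, b], vector [0, d]]"

lemma upper_tri_nth [simp]:
  "upper_tri a b d $ 1 $ 1 = a" "upper_tri a b d $ 1 $ 2 = b"
  "upper_tri a b d $ 2 $ 1 = 0" "upper_tri a b d $ 2 $ 2 = d"
  by (simp_all add: upper_tri_def)

lemma upper_tri_mult:
  "upper_tri a b d ** upper_tri a' b' d' = upper_tri (a * a') (a * b' + b * d') (d * d')"
  by (simp add: vec_eq_iff forall_2 matrix_matrix_mult_def sum_2)

lemma det_upper_tri [simp]: "det (upper_tri a b d) = a * d"
  by (simp add: det_2)

lemma upper_tri_eq_mat_1: "upper_tri 1 0 1 = mat 1"
  by (simp add: vec_eq_iff forall_2 mat_def)

text \<open>Exposes the entries as scalar coefficients of constant matrices, so that
  differentiability and continuity reduce to those of real functions.\<close>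

lemma upper_tri_expand:
  "upper_tri a b d = a *\<^sub>R upper_tri 1 0 0 + b *\<^sub>R upper_tri 0 1 0 + d *\<^sub>R upper_tri 0 0 1"
  by (simp add: vec_eq_iff forall_2)

lemma norm_diagonal: "norm (upper_tri a 0 d) = sqrt (a\<^sup>2 + d\<^sup>2)"
  by (simp add: norm_vec_def L2_set_def sum_2)

definition geodesic_mat :: "real \<Rightarrow> real^2^2" where
  "geodesic_mat t = upper_tri (exp (t / 2)) 0 (exp (- t / 2))"

definition horocycle_mat :: "real \<Rightarrow> real^2^2" where
  "horocycle_mat t = upper_tri 1 t 1"

lemma det_geodesic_mat [simp]: "det (geodesic_mat t) = 1"
  by (simp add: geodesic_mat_def flip: exp_add)

lemma det_horocycle_mat [simp]: "det (horocycle_mat t) = 1"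
  by (simp add: horocycle_mat_def)

lemma b_elem_eq: "b_elem t = psl (horocycle_mat t)"
  by (simp add: b_elem_def horocycle_mat_def upper_tri_def)

text \<open>Conjugation by a diagonal matrix rescales a unipotent one: both products have the upper
  right entry \<open>t * exp (- r / 2)\<close>.\<close>

lemma geodesic_horocycle_commute:
  "geodesic_mat r ** horocycle_mat (t * exp (- r)) = horocycle_mat t ** geodesic_mat r"
proof -
  have "exp (r / 2) * exp (- r) = exp (- (r / 2))"
    by (simp flip: exp_add)
  then show ?thesis
    by (simp add: geodesic_mat_def horocycle_mat_def upper_tri_mult mult.left_commute)
qed

lemma geodesic_mat_0: "geodesic_mat 0 = mat 1"
  by (simp add: geodesic_mat_def upper_tri_eq_mat_1)

text \<open>The diagonal matrices form a one-parameter group generated by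
  \<open>diag(1/2,-1/2)\<close>. The velocity is thus the curve times a fixed matrix, which makes
  the left-invariant speed constant.\<close>

lemma has_vector_derivative_geodesic_mat:
  "((\<lambda>s. A ** geodesic_mat (r * s)) has_vector_derivative
     (A ** geodesic_mat (r * s)) ** upper_tri (r / 2) 0 (- r / 2)) (at s)"
proof -
  have "((\<lambda>s. geodesic_mat (r * s)) has_vector_derivative
      upper_tri (r / 2 * exp (r * s / 2)) 0 (- r / 2 * exp (- (r * s) / 2))) (at s)"
    unfolding geodesic_mat_def upper_tri_expand[of "exp _"] upper_tri_expand[of "_ * _"]
    by (auto intro!: derivative_eq_intros simp: has_vector_derivative_def fun_eq_iff algebra_simps)
  then have "((\<lambda>s. A ** geodesic_mat (r * s)) has_vector_derivative
      A ** upper_tri (r / 2 * exp (r * s / 2)) 0 (- r / 2 * exp (- (r * s) / 2))) (at s)"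
    by (rule bounded_linear.has_vector_derivative[rotated])
       (auto intro!: linear_conv_bounded_linear[THEN iffD1] linearI
         simp: matrix_add_ldistrib matrix_scalar_ac scalar_matrix_assoc)
  then show ?thesis
    by (simp add: geodesic_mat_def upper_tri_mult mult.commute flip: matrix_mul_assoc)
qed

section \<open>Upper bounds for the distances\<close>

text \<open>On the reals, \<open>Inf\<close> is known to lie below the members of a set only if the
  set is bounded below; here lengths are nonnegative.\<close>

lemma bdd_below_path_lengths:
  "bdd_below {L. \<exists>c. valid_path c \<and> path_image c \<subseteq> carrier SL2 \<and>
      psl (pathstart c) = g \<and> psl (pathfinish c) = h \<and>
      ((\<lambda>s. norm (matrix_inv (c s) ** vector_derivative c (at s within {0..1})))
         has_integral L) {0..1}}"
  by (rule bdd_belowI[of _ 0]) (auto intro: has_integral_nonneg)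

text \<open>\<open>Inf {}\<close> is the junk value of the distance if \<open>g\<close> and \<open>h\<close> are not joined by a path.\<close>

lemma dist_PSL2_bounded_below: "min 0 (Inf {}) \<le> dist_PSL2 g h"
proof -
  define S where "S = {L. \<exists>c. valid_path c \<and> path_image c \<subseteq> carrier SL2 \<and>
      psl (pathstart c) = g \<and> psl (pathfinish c) = h \<and>
      ((\<lambda>s. norm (matrix_inv (c s) ** vector_derivative c (at s within {0..1})))
         has_integral L) {0..1}}"
  have "0 \<le> L" if "L \<in> S" for L
    using that by (auto simp: S_def intro: has_integral_nonneg)
  then have "S = {} \<or> 0 \<le> Inf S"
    using cInf_greatest[of S 0] by auto
  then show ?thesis
    by (auto simp: dist_PSL2_def simp flip: S_def)
qed

text \<open>The translated geodesic segment is an admissible path from \<open>g\<close> to the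
  second point, so its length bounds the infimum.\<close>

lemma dist_PSL2_geodesic_le:
  assumes g: "g \<in> carrier PSL2"
  shows "dist_PSL2 g (g \<otimes>\<^bsub>PSL2\<^esub> psl (geodesic_mat r)) \<le> \<bar>r\<bar>"
proof -
  obtain A where A: "g = psl A" "det A = 1" using g by (auto simp: carrier_PSL2)
  define c where "c = (\<lambda>s. A ** geodesic_mat (r * s))"
  define V where "V = upper_tri (r / 2) 0 (- r / 2)"
  have deriv: "(c has_vector_derivative c s ** V) (at s)" for s
    unfolding c_def V_def by (rule has_vector_derivative_geodesic_mat)
  have det: "det (c s) = 1" for s by (simp add: c_def det_mul A)
  have "continuous_on UNIV c"
    using deriv by (intro continuous_at_imp_continuous_on)
      (auto intro: has_vector_derivative_continuous)
  moreover have "bounded_linear (\<lambda>B. B ** V)"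
    by (auto intro!: linear_conv_bounded_linear[THEN iffD1] linearI
         simp: vec_eq_iff matrix_matrix_mult_def sum_2 algebra_simps)
  ultimately have "continuous_on {0..1} (\<lambda>s. c s ** V)"
    by (blast intro: bounded_linear.continuous_on[of "\<lambda>B. B ** V"] continuous_on_subset)
  then have "c C1_differentiable_on {0..1}"
    using deriv unfolding C1_differentiable_on_def by (intro exI[of _ "\<lambda>s. c s ** V"]) auto
  then have valid: "valid_path c"
    by (simp add: valid_path_def C1_differentiable_imp_piecewise)
  \<comment> \<open>The derivative within \<open>{0..1}\<close> is one-sided at the endpoints, yet
    agrees there with the two-sided one; the factor \<open>c s\<close> then cancels.\<close>
  have speed: "matrix_inv (c s) ** vector_derivative c (at s within {0..1}) = V"
    if "s \<in> {0..1}" for s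
  proof -
    have "vector_derivative c (at s within {0..1}) = c s ** V"
      using that deriv by (intro vector_derivative_at_within_ivl) auto
    moreover have "invertible (c s)" by (simp add: det invertible_det_nz)
    then have "matrix_inv (c s) ** c s = mat 1"
      unfolding invertible_def matrix_inv_def by (rule someI2_ex) blast
    ultimately show ?thesis by (simp add: matrix_mul_assoc)
  qed
  have "((\<lambda>s. norm V) has_integral norm V) {0..1::real}"
    using has_integral_const_real[of "norm V" 0 1] by simp
  then have int: "((\<lambda>s. norm (matrix_inv (c s) ** vector_derivative c (at s within {0..1})))
         has_integral norm V) {0..1}"
    by (rule has_integral_eq[rotated]) (simp add: speed)
  have "path_image c \<subseteq> carrier SL2" using det by (auto simp: path_image_def SL2_def)
  moreover have "psl (pathstart c) = g" by (simp add: pathstart_def c_def geodesic_mat_0 A)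
  moreover have "psl (pathfinish c) = g \<otimes>\<^bsub>PSL2\<^esub> psl (geodesic_mat r)"
    by (simp add: pathfinish_def c_def A psl_mult)
  ultimately have "dist_PSL2 g (g \<otimes>\<^bsub>PSL2\<^esub> psl (geodesic_mat r)) \<le> norm V"
    unfolding dist_PSL2_def using valid int
    by (intro cInf_lower bdd_below_path_lengths) blast
  \<comment> \<open>The exact length is \<open>\<bar>r\<bar> / sqrt 2\<close>; the rougher bound
    \<open>\<bar>r\<bar>\<close> suffices.\<close>
  also have "norm V \<le> sqrt (r\<^sup>2)"
    unfolding V_def norm_diagonal by (intro real_sqrt_le_mono) (simp add: power_divide)
  finally show ?thesis by simp
qed

text \<open>The representatives picked by \<open>SOME\<close> differ from the given ones by elements
  of \<open>\<Gamma>\<close>. One member of the family under the infimum compensates for both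
  choices and reduces the claim to the bound in the group.\<close>

lemma dist_X_geodesic_le:
  assumes \<Gamma>: "subgroup \<Gamma> PSL2" and h: "h \<in> carrier PSL2"
  shows "dist_X \<Gamma> (\<Gamma> #>\<^bsub>PSL2\<^esub> h) (\<Gamma> #>\<^bsub>PSL2\<^esub> (h \<otimes>\<^bsub>PSL2\<^esub> psl (geodesic_mat r))) \<le> \<bar>r\<bar>"
proof -
  interpret Group.group PSL2 by (rule group_PSL2)
  interpret \<Gamma>: subgroup \<Gamma> PSL2 by (rule \<Gamma>)
  let ?a = "psl (geodesic_mat r)"
  have a: "?a \<in> carrier PSL2" by (auto simp: carrier_PSL2)
  let ?g1 = "SOME g. g \<in> \<Gamma> #>\<^bsub>PSL2\<^esub> h" and ?g2 = "SOME g. g \<in> \<Gamma> #>\<^bsub>PSL2\<^esub> (h \<otimes>\<^bsub>PSL2\<^esub> ?a)"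
  have "?g1 \<in> \<Gamma> #>\<^bsub>PSL2\<^esub> h" by (rule someI) (rule rcos_self[OF h \<Gamma>])
  then obtain k1 where k1: "k1 \<in> \<Gamma>" "?g1 = k1 \<otimes>\<^bsub>PSL2\<^esub> h" by (auto simp: r_coset_def)
  have "?g2 \<in> \<Gamma> #>\<^bsub>PSL2\<^esub> (h \<otimes>\<^bsub>PSL2\<^esub> ?a)"
    using h a by (intro someI) (rule rcos_self[OF _ \<Gamma>], simp)
  then obtain k2 where k2: "k2 \<in> \<Gamma>" "?g2 = k2 \<otimes>\<^bsub>PSL2\<^esub> (h \<otimes>\<^bsub>PSL2\<^esub> ?a)"
    by (auto simp: r_coset_def)
  \<comment> \<open>This element undoes \<open>k2\<close> and applies \<open>k1\<close>, turning
    \<open>?g2\<close> into \<open>?g1\<close> shifted by the diagonal element.\<close>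
  let ?k = "k1 \<otimes>\<^bsub>PSL2\<^esub> inv\<^bsub>PSL2\<^esub> k2"
  have "?k \<otimes>\<^bsub>PSL2\<^esub> ?g2 = k1 \<otimes>\<^bsub>PSL2\<^esub> (inv\<^bsub>PSL2\<^esub> k2 \<otimes>\<^bsub>PSL2\<^esub> k2) \<otimes>\<^bsub>PSL2\<^esub> (h \<otimes>\<^bsub>PSL2\<^esub> ?a)"
    unfolding k2(2) using k1(1) k2(1) h a
    by (simp only: m_assoc \<Gamma>.mem_carrier inv_closed m_closed)
  also have "\<dots> = ?g1 \<otimes>\<^bsub>PSL2\<^esub> ?a"
    unfolding k1(2) using k1(1) k2(1) h a
    by (simp only: m_assoc \<Gamma>.mem_carrier inv_closed m_closed l_inv r_one l_one)
  finally have eq: "?k \<otimes>\<^bsub>PSL2\<^esub> ?g2 = ?g1 \<otimes>\<^bsub>PSL2\<^esub> ?a" .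
  have "(INF \<gamma>\<in>\<Gamma>. dist_PSL2 ?g1 (\<gamma> \<otimes>\<^bsub>PSL2\<^esub> ?g2)) \<le> dist_PSL2 ?g1 (?k \<otimes>\<^bsub>PSL2\<^esub> ?g2)"
  proof (rule cINF_lower)
    \<comment> \<open>The lower bound covers the default value of the distance too, so it is uniform
      over \<open>\<Gamma>\<close>.\<close>
    show "bdd_below ((\<lambda>\<gamma>. dist_PSL2 ?g1 (\<gamma> \<otimes>\<^bsub>PSL2\<^esub> ?g2)) ` \<Gamma>)"
      by (rule bdd_belowI2) (rule dist_PSL2_bounded_below)
  qed (use k1 k2 in simp)
  also have "\<dots> \<le> \<bar>r\<bar>"
    unfolding eq using k1 h by (intro dist_PSL2_geodesic_le) simp
  finally show ?thesis by (simp add: dist_X_def Let_def)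
qed

section \<open>Failure of expansiveness\<close>

lemma horocycle_X_coset:
  assumes "subgroup \<Gamma> PSL2" "g \<in> carrier PSL2"
  shows "horocycle_X t (\<Gamma> #>\<^bsub>PSL2\<^esub> g) = \<Gamma> #>\<^bsub>PSL2\<^esub> (g \<otimes>\<^bsub>PSL2\<^esub> b_elem t)"
proof -
  interpret Group.group PSL2 by (rule group_PSL2)
  have "b_elem t \<in> carrier PSL2" by (auto simp: b_elem_eq carrier_PSL2)
  then show ?thesis
    unfolding horocycle_X_def using assms by (intro coset_mult_assoc subgroup.subset)
qed

text \<open>Discreteness isolates the identity in \<open>\<Gamma>\<close>, while the product is near
  the identity for small parameters. Its upper left entry \<open>exp (r / 2)\<close> then determines
  \<open>r\<close>.\<close>

lemma discrete_subgroup_avoids_triangular: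
  assumes \<Gamma>: "subgroup \<Gamma> PSL2"
    and discrete: "subtopology PSL2_topology \<Gamma> = discrete_topology \<Gamma>"
  obtains \<epsilon> where "\<epsilon> > 0"
    "\<And>r \<tau>. \<bar>r\<bar> < \<epsilon> \<Longrightarrow> \<bar>\<tau>\<bar> < \<epsilon> \<Longrightarrow> psl (geodesic_mat r ** horocycle_mat \<tau>) \<in> \<Gamma> \<Longrightarrow> r = 0"
proof -
  interpret \<Gamma>: subgroup \<Gamma> PSL2 by (rule \<Gamma>)
  have "openin (subtopology PSL2_topology \<Gamma>) {\<one>\<^bsub>PSL2\<^esub>}"
    using discrete by simp
  then obtain U where U: "openin PSL2_topology U" "{\<one>\<^bsub>PSL2\<^esub>} = U \<inter> \<Gamma>"
    by (auto simp: openin_subtopology)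
  \<comment> \<open>By the definition of the quotient topology, \<open>U\<close> pulls back to an
    open subset of \<open>SL2\<close>, which contains a relative ball about
    \<open>mat 1\<close>.\<close>
  have "openin (top_of_set {A. det A = 1}) {A \<in> {A. det A = 1}. psl A \<in> U}"
    using U(1) by (simp add: PSL2_topology_def openin_quotient_topology SL2_def)
  moreover have "mat 1 \<in> {A \<in> {A. det A = 1}. psl A \<in> U}"
    using U(2) by (auto simp: one_PSL2)
  ultimately have "\<exists>e>0. \<forall>A\<in>{A. det A = 1}. dist A (mat 1) < e \<longrightarrow> A \<in> {A \<in> {A. det A = 1}. psl A \<in> U}"
    unfolding openin_euclidean_subtopology_iff by (elim conjE bspec)
  then obtain e where e: "e > 0" "\<And>A. det A = 1 \<Longrightarrow> dist A (mat 1) < e \<Longrightarrow> psl A \<in> U"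
    by auto
  define F where "F = (\<lambda>p. geodesic_mat (fst p) ** horocycle_mat (snd p))"
  have F: "F p = upper_tri (exp (fst p / 2)) (snd p * exp (fst p / 2)) (exp (- fst p / 2))" for p
    by (simp add: F_def geodesic_mat_def horocycle_mat_def upper_tri_mult mult.commute)
  have "isCont F (0, 0)"
    unfolding F upper_tri_expand[of "exp _"] by (intro continuous_intros) auto
  moreover have "F (0, 0) = mat 1" by (simp add: F upper_tri_eq_mat_1)
  ultimately obtain d where d: "d > 0" "\<And>p. dist p (0, 0) < d \<Longrightarrow> dist (F p) (mat 1) < e"
    unfolding continuous_at_eps_delta using e(1) by metis
  show ?thesis
  proof (rule that[of "d / 2"])
    fix r \<tau> assume r: "\<bar>r\<bar> < d / 2" and \<tau>: "\<bar>\<tau>\<bar> < d / 2"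
      and mem: "psl (geodesic_mat r ** horocycle_mat \<tau>) \<in> \<Gamma>"
    \<comment> \<open>Halving \<open>d\<close> pays for bounding the norm of a pair by the sum of
      its coordinates.\<close>
    have "norm (r, \<tau>) \<le> \<bar>r\<bar> + \<bar>\<tau>\<bar>"
      using norm_Pair_le[of r \<tau>] by simp
    then have "dist (r, \<tau>) (0, 0) < d"
      using r \<tau> by (simp add: dist_norm flip: zero_prod_def)
    then have "psl (F (r, \<tau>)) \<in> U"
      by (intro e d) (simp_all add: F_def det_mul)
    with mem U(2) have "psl (F (r, \<tau>)) = psl (mat 1)"
      by (auto simp: F_def one_PSL2)
    \<comment> \<open>Equality of classes fixes the matrix only up to sign; positivity of the
      exponential entry rules out the minus sign.\<close>
    then have "F (r, \<tau>) = mat 1 \<or> F (r, \<tau>) = - mat 1"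
      by (auto simp: psl_eq doubleton_eq_iff)
    then have "F (r, \<tau>) $ 1 $ 1 = 1 \<or> F (r, \<tau>) $ 1 $ 1 = - 1"
      by (auto simp: mat_def)
    then have "exp (r / 2) = 1"
      using exp_gt_zero[of "r / 2"] by (auto simp: F simp del: exp_gt_zero)
    then show "r = 0" by simp
  qed (use d in simp)
qed

theorem mainTheorem4:
  fixes \<Gamma> :: "(real^2^2) set set"
  assumes "subgroup \<Gamma> PSL2"
    and "subtopology PSL2_topology \<Gamma> = discrete_topology \<Gamma>"
    and "acts_freely_on_H2 \<Gamma>"
    and "compact_space (quotient_H2 \<Gamma>)"
  shows "\<not> BW_expansive (T1_quotient \<Gamma>) (dist_T1 \<Gamma>) (horocycle_T1 \<Gamma>)"
proof
  assume expansive: "BW_expansive (T1_quotient \<Gamma>) (dist_T1 \<Gamma>) (horocycle_T1 \<Gamma>)"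
  note \<Gamma> = assms(1)
  interpret Group.group PSL2 by (rule group_PSL2)
  interpret \<Gamma>: subgroup \<Gamma> PSL2 by (rule \<Gamma>)
  have psl_closed: "psl A \<in> carrier PSL2" if "det A = 1" for A
    using that by (auto simp: carrier_PSL2)
  note bij = bij_betw_Xi_inv[OF \<Gamma>]
  have coset: "\<Gamma> #>\<^bsub>PSL2\<^esub> g \<in> rcosets\<^bsub>PSL2\<^esub> \<Gamma>" if "g \<in> carrier PSL2" for g
    using that by (intro rcosetsI) (auto simp: \<Gamma>.subset)
  have Xi: "Xi \<Gamma> (Xi_inv \<Gamma> (\<Gamma> #>\<^bsub>PSL2\<^esub> g)) = \<Gamma> #>\<^bsub>PSL2\<^esub> g" if "g \<in> carrier PSL2" for g
    unfolding Xi_def using bij coset[OF that] by (intro inv_into_f_f) (auto simp: bij_betw_def)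
  \<comment> \<open>Through \<open>Xi\<close>, the flow becomes right multiplication of matrix
    representatives.\<close>
  have flow: "horocycle_T1 \<Gamma> t (Xi_inv \<Gamma> (\<Gamma> #>\<^bsub>PSL2\<^esub> psl A))
      = Xi_inv \<Gamma> (\<Gamma> #>\<^bsub>PSL2\<^esub> psl (A ** horocycle_mat t))" if "det A = 1" for A t
    using that psl_closed
    by (simp add: horocycle_T1_def Xi horocycle_X_coset[OF \<Gamma>] b_elem_eq psl_mult)
  obtain \<epsilon> where \<epsilon>: "\<epsilon> > 0"
    "\<And>r \<tau>. \<bar>r\<bar> < \<epsilon> \<Longrightarrow> \<bar>\<tau>\<bar> < \<epsilon> \<Longrightarrow> psl (geodesic_mat r ** horocycle_mat \<tau>) \<in> \<Gamma> \<Longrightarrow> r = 0"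
    using discrete_subgroup_avoids_triangular[OF \<Gamma> assms(2)] by blast
  obtain \<delta> where \<delta>: "\<delta> > 0"
    "\<And>x y s. x \<in> T1_quotient \<Gamma> \<Longrightarrow> y \<in> T1_quotient \<Gamma> \<Longrightarrow> continuous_on UNIV s \<Longrightarrow> s 0 = 0 \<Longrightarrow>
       (\<And>t. dist_T1 \<Gamma> (horocycle_T1 \<Gamma> t x) (horocycle_T1 \<Gamma> (s t) y) < \<delta>) \<Longrightarrow>
       \<exists>\<tau>\<in>{-\<epsilon><..<\<epsilon>}. y = horocycle_T1 \<Gamma> \<tau> x"
    using expansive \<epsilon>(1) unfolding BW_expansive_def by metis
  \<comment> \<open>Positive, yet below \<open>\<delta>\<close> to keep the orbits close and below
    \<open>\<epsilon>\<close> to apply the isolation of the identity.\<close>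
  define r where "r = min \<epsilon> \<delta> / 2"
  have r: "0 < r" "r < \<epsilon>" "r < \<delta>" using \<epsilon>(1) \<delta>(1) by (auto simp: r_def)
  define x where "x = Xi_inv \<Gamma> (\<Gamma> #>\<^bsub>PSL2\<^esub> psl (mat 1))"
  define y where "y = Xi_inv \<Gamma> (\<Gamma> #>\<^bsub>PSL2\<^esub> psl (geodesic_mat r))"
  define s where "s = (\<lambda>t. t * exp (- r))"
  have xy: "x \<in> T1_quotient \<Gamma>" "y \<in> T1_quotient \<Gamma>"
    unfolding x_def y_def using bij_betwE[OF bij] by (simp_all add: coset psl_closed)
  have close: "dist_T1 \<Gamma> (horocycle_T1 \<Gamma> t x) (horocycle_T1 \<Gamma> (s t) y) < \<delta>" for t
  proof -
    \<comment> \<open>The time change \<open>s\<close> moves the diagonal factor to the right: at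
      every time the second point is the first one shifted by the same
      \<open>geodesic_mat r\<close>.\<close>
    have "dist_T1 \<Gamma> (horocycle_T1 \<Gamma> t x) (horocycle_T1 \<Gamma> (s t) y)
        = dist_X \<Gamma> (\<Gamma> #>\<^bsub>PSL2\<^esub> psl (horocycle_mat t))
            (\<Gamma> #>\<^bsub>PSL2\<^esub> (psl (horocycle_mat t) \<otimes>\<^bsub>PSL2\<^esub> psl (geodesic_mat r)))"
      by (simp add: x_def y_def s_def flow dist_T1_def Xi psl_closed psl_mult det_mul
          geodesic_horocycle_commute)
    also have "\<dots> \<le> \<bar>r\<bar>" by (intro dist_X_geodesic_le \<Gamma> psl_closed) simp
    finally show ?thesis using r by simp
  qed
  have "continuous_on UNIV s" "s 0 = 0" unfolding s_def by (auto intro!: continuous_intros)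
  from \<delta>(2)[OF xy this close] obtain \<tau> where "\<tau> \<in> {-\<epsilon><..<\<epsilon>}" "y = horocycle_T1 \<Gamma> \<tau> x" ..
  then have \<tau>: "\<bar>\<tau>\<bar> < \<epsilon>" "y = horocycle_T1 \<Gamma> \<tau> x" by auto
  \<comment> \<open>Applying \<open>Xi\<close> turns the equality of tangent vectors into one of
    cosets, hence into one in the group up to some \<open>k\<close> in
    \<open>\<Gamma>\<close>.\<close>
  have "Xi \<Gamma> y = Xi \<Gamma> (horocycle_T1 \<Gamma> \<tau> x)" using \<tau>(2) by simp
  then have "\<Gamma> #>\<^bsub>PSL2\<^esub> psl (geodesic_mat r) = \<Gamma> #>\<^bsub>PSL2\<^esub> psl (horocycle_mat \<tau>)"
    by (simp add: x_def y_def flow Xi psl_closed)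
  then have "psl (geodesic_mat r) \<in> \<Gamma> #>\<^bsub>PSL2\<^esub> psl (horocycle_mat \<tau>)"
    using rcos_self[OF psl_closed \<Gamma>, of "geodesic_mat r"] by simp
  then obtain k where k: "k \<in> \<Gamma>" "psl (geodesic_mat r) = k \<otimes>\<^bsub>PSL2\<^esub> psl (horocycle_mat \<tau>)"
    by (auto simp: r_coset_def)
  \<comment> \<open>Cancelling the horocycle factor on the right exhibits \<open>k\<close> as a
    small triangular element of \<open>\<Gamma>\<close>, which forces \<open>r = 0\<close>.\<close>
  have "horocycle_mat \<tau> ** horocycle_mat (- \<tau>) = mat 1"
    by (simp add: horocycle_mat_def upper_tri_mult upper_tri_eq_mat_1)
  then have "psl (geodesic_mat r ** horocycle_mat (- \<tau>)) = k"
    using k by (simp add: psl_closed m_assoc psl_mult flip: psl_mult[of "geodesic_mat r"] one_PSL2)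
  then show False using \<epsilon>(2)[of r "- \<tau>"] k(1) \<tau>(1) r by simp
qed

end
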